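(* Let $\mathfrak h$ be a (right) Leibniz algebra over a field $k$ and let $C=k\oplus\mathfrak h$ be the associated rack bialgebra. Then the Leibniz cohomology complex of $\mathfrak h$ with values in the adjoint representation embeds into the deformation complex $(C^*(C;C),d_C^* )$ of the rack bialgebra $C$.
   Context: Everything is over a field $k$; Sweedler notation is written with upper indices, $\triangle(r)=r^{(1)}\otimes r^{(2)}$, and similarly for iterated coproducts. A right Leibniz algebra is a vector space $\mathfrak h$ with a bilinear bracket satisfying $[[x,y],z]=[[x,z],y]+[x,[y,z]]$. A rack bialgebra is a coassociative counital coalgebra $(C,\triangle,\epsilon)$ with a distinguished group-like element $1$ together with a coalgebra morphism $\lhd\colon C\otimes C\to C$ such that $(x\lhd y)\lhd z=(x\lhd z^{(1)})\lhd(y\lhd z^{(2)})$, $x\lhd 1=x$, $1\lhd x=\epsilon(x)1$, $\epsilon(x\lhd y)=\epsilon(x)\epsilon(y)$ for all $x,y,z\in C$. The rack bialgebra associated to $\mathfrak h$ is $C=k\cdot 1\oplus\mathfrak h$, where $\triangle(1)=1\otimes 1$, $\epsilon(1)=1$, every $x\in\mathfrak h$ is primitive ($\triangle(x)=1\otimes x+x\otimes 1$, $\epsilon(x)=0$), and $x\lhd y=[x,y]$, $1\lhd x=\epsilon(x)1$, $x\lhd1=x$ for $x,y\in\mathfrak h$ (and $1\lhd 1=1$). It is cocommutative. The Leibniz (Loday) cohomology complex of $\mathfrak h$ with values in the adjoint representation is the standard complex with cochains $\mathrm{Hom}_k(\mathfrak h^{\otimes n},\mathfrak h)$ in degree $n$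 and differential $$(d^nf)(x_1,\dots,x_{n+1})=[x_1,f(x_2,\dots,x_{n+1})]+\sum_{i=2}^{n+1}(-1)^i[f(x_1,\dots,\widehat{x_i},\dots,x_{n+1}),x_i]$$ $$+\sum_{1\le i<j\le n+1}(-1)^{j+1}f(x_1,\dots,x_{i-1},[x_i,x_j],x_{i+1},\dots,\widehat{x_j},\dots,x_{n+1}).$$ Deformation complex of a rack bialgebra $C$ with cocommutative underlying coalgebra: let $\mu(x,y)=x\lhd y$ and $\mu^n(x_1,\dots,x_n)=(\dots(x_1\lhd x_2)\lhd\dots)\lhd x_n$, with the convention $\mu^1=\mathrm{id}$, $\mu^2=\mu$. The deformation complex is the graded vector space $C^*(C;C)$ defined in degree $n$ by $C^n(C;C)=\mathrm{Coder}(C^{\otimes n},C,\mu^n)$, the space of coderivations along $\mu^n$, i.e. of linear maps $\omega\colon C^{\otimes n}\to C$ with $\triangle_C\circ\omega=(\omega\otimes\mu^n+\mu^n\otimes\omega)\circ\triangle_{C^{\otimes n}}$, where $\triangle_{C^{\otimes n}}$ is the coproduct of the tensor product coalgebra $C^{\otimes n}$. It is endowed with the differential $d_C\colon C^*(C;C)\to C^{*+1}(C;C)$ defined in degree $n$ by $$d_C^n=\sum_{i=1}^{n}(-1)^{i+1}(d_{i,1}^n-d_{i,0}^n)+(-1)^{n+1}d_{n+1}^n,$$ where for $\omega\in C^n(C;C)$ and $r_1,\dots,r_{n+1}\in C$ $$d_{i,1}^n\omega(r_1,\dots,r_{n+1})=\omega(r_1,\dots,r_{i-1},r_{i+1}^{(1)},\dots,r_{n+1}^{(1)})\lhd\mu^{n-i+2}(r_i,r_{i+1}^{(2)},\dots,r_{n+1}^{(2)}),$$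 $$d_{i,0}^n\omega(r_1,\dots,r_{n+1})=\omega(r_1\lhd r_i^{(1)},\dots,r_{i-1}\lhd r_i^{(i-1)},r_{i+1},\dots,r_{n+1}),$$ $$d_{n+1}^n\omega(r_1,\dots,r_{n+1})=\mu^n(r_1,r_3^{(1)},\dots,r_{n+1}^{(1)})\lhd\omega(r_2,r_3^{(2)},\dots,r_{n+1}^{(2)}).$$
   Formalization: The printed differential d_C is corrected: in its sum, d_{i,1} and d_{i,0} are replaced by d_{n+2-i,1} and d_{n+2-i,0} (so r_2,…,r_{n+1} act, not r_1,…,r_n); as printed the claim fails for the nonabelian 2-dimensional Lie algebra. *)

theory Defs
  imports "HOL-Analysis.Product_Vector" "HOL-Library.Poly_Mapping"
begin

section \<open>Linear maps on tensor powers\<close>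

text \<open>
  A linear map on the \<open>n\<close>-th tensor power is given by the corresponding multilinear map,
  as a function on lists of length \<open>n\<close>. The value \<open>0\<close> on lists of any other length makes this
  representation unique, so that equality of functions is equality of linear maps.
\<close>

definition tensor_hom ::
  "('k::field \<Rightarrow> 'a::ab_group_add \<Rightarrow> 'a) \<Rightarrow> ('k \<Rightarrow> 'b::ab_group_add \<Rightarrow> 'b) \<Rightarrow> nat \<Rightarrow> ('a list \<Rightarrow> 'b) set"
where
  "tensor_hom s1 s2 n = {f.
     (\<forall>xs i. length xs = n \<and> i < n \<longrightarrow> Vector_Spaces.linear s1 s2 (\<lambda>a. f (xs[i := a]))) \<and>
     (\<forall>xs. length xs \<noteq> n \<longrightarrow> f xs = 0)}"

section \<open>Equality of tensors\<close>

text \<open>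
  A list of lists stands for a formal sum of pure tensors (Sweedler notation): the inner list
  \<open>[a\<^sub>1, \<dots>, a\<^sub>m]\<close> stands for the tensor product of the \<open>a\<^sub>i\<close>. Two formal sums are
  equal as tensors if their difference in the free vector space on all lists lies in the span
  of the relations of multilinearity. The quotient is the direct sum of all tensor powers.
\<close>

definition tensor_rel :: "('k::field \<Rightarrow> 'c::ab_group_add \<Rightarrow> 'c) \<Rightarrow> ('c list \<Rightarrow>\<^sub>0 'k) set" where
  "tensor_rel s =
     {Poly_Mapping.single (xs @ (a + b) # ys) 1
        - Poly_Mapping.single (xs @ a # ys) 1 - Poly_Mapping.single (xs @ b # ys) 1 | xs a b ys. True}
     \<union> {Poly_Mapping.single (xs @ s c a # ys) 1 - Poly_Mapping.single (xs @ a # ys) c | xs c a ys. True}"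

definition formal_sum :: "'c list list \<Rightarrow> ('c list \<Rightarrow>\<^sub>0 'k::field)" where
  "formal_sum S = (\<Sum>xs\<leftarrow>S. Poly_Mapping.single xs 1)"

definition tensor_eq ::
  "('k::field \<Rightarrow> 'c::ab_group_add \<Rightarrow> 'c) \<Rightarrow> 'c list list \<Rightarrow> 'c list list \<Rightarrow> bool"
where
  "tensor_eq s S T \<longleftrightarrow>
     formal_sum S - formal_sum T \<in> module.span (\<lambda>c. Poly_Mapping.map ((*) c)) (tensor_rel s)"

definition tensor_eq2 ::
  "('k::field \<Rightarrow> 'c::ab_group_add \<Rightarrow> 'c) \<Rightarrow> ('c \<times> 'c) list \<Rightarrow> ('c \<times> 'c) list \<Rightarrow> bool"
where
  "tensor_eq2 s S T \<longleftrightarrow> tensor_eq s (map (\<lambda>(a, b). [a, b]) S) (map (\<lambda>(a, b). [a, b]) T)"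

section \<open>Rack bialgebras\<close>

text \<open>
  \<open>comul C r\<close> is a Sweedler representative of the coproduct of \<open>r\<close>, i.e. a list of
  pairs \<open>(r\<^sup>(\<^sup>1\<^sup>), r\<^sup>(\<^sup>2\<^sup>))\<close>; the coproduct itself is its class modulo \<^const>\<open>tensor_eq2\<close>.
\<close>

record ('k, 'c) rack_data =
  scl :: "'k \<Rightarrow> 'c \<Rightarrow> 'c"
  comul :: "'c \<Rightarrow> ('c \<times> 'c) list"
  counit :: "'c \<Rightarrow> 'k"
  gunit :: 'c
  rack :: "'c \<Rightarrow> 'c \<Rightarrow> 'c"

locale rack_bialgebra =
  fixes C :: "('k::field, 'c::ab_group_add) rack_data"
  assumes vector_space: "vector_space (scl C)"
    and comul_add: "tensor_eq2 (scl C) (comul C (x + y)) (comul C x @ comul C y)"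
    and comul_scale: "tensor_eq2 (scl C) (comul C (scl C c x)) [(scl C c a, b). (a, b) \<leftarrow> comul C x]"
    and linear_counit: "Vector_Spaces.linear (scl C) (*) (counit C)"
    and coassoc: "tensor_eq (scl C)
          [[a1, a2, b]. (a, b) \<leftarrow> comul C x, (a1, a2) \<leftarrow> comul C a]
          [[a, b1, b2]. (a, b) \<leftarrow> comul C x, (b1, b2) \<leftarrow> comul C b]"
    and counit_left: "(\<Sum>(a, b)\<leftarrow>comul C x. scl C (counit C a) b) = x"
    and counit_right: "(\<Sum>(a, b)\<leftarrow>comul C x. scl C (counit C b) a) = x"
    and comul_unit: "tensor_eq2 (scl C) (comul C (gunit C)) [(gunit C, gunit C)]"
    and counit_unit: "counit C (gunit C) = 1"
    and linear_rack_left: "Vector_Spaces.linear (scl C) (scl C) (\<lambda>x. rack C x y)"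
    and linear_rack_right: "Vector_Spaces.linear (scl C) (scl C) (\<lambda>y. rack C x y)"
    and comul_rack: "tensor_eq2 (scl C) (comul C (rack C x y))
          [(rack C a c, rack C b d). (a, b) \<leftarrow> comul C x, (c, d) \<leftarrow> comul C y]"
    and counit_rack: "counit C (rack C x y) = counit C x * counit C y"
    and self_distrib: "rack C (rack C x y) z =
          (\<Sum>(a, b)\<leftarrow>comul C z. rack C (rack C x a) (rack C y b))"
    and rack_unit: "rack C x (gunit C) = x"
    and unit_rack: "rack C (gunit C) x = scl C (counit C x) (gunit C)"

definition cocommutative :: "('k::field, 'c::ab_group_add) rack_data \<Rightarrow> bool" where
  "cocommutative C \<longleftrightarrow>
     (\<forall>x. tensor_eq2 (scl C) (comul C x) [(b, a). (a, b) \<leftarrow> comul C x])"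

section \<open>The deformation complex of a rack bialgebra\<close>

text \<open>Coproduct of the tensor product coalgebra, on pure tensors.\<close>

fun tensor_comul :: "('k, 'c) rack_data \<Rightarrow> 'c list \<Rightarrow> ('c list \<times> 'c list) list" where
  "tensor_comul C [] = [([], [])]"
| "tensor_comul C (r # rs) =
     [(a # as, b # bs). (a, b) \<leftarrow> comul C r, (as, bs) \<leftarrow> tensor_comul C rs]"

text \<open>\<open>iter_comul C m r\<close> lists the tuples \<open>[r\<^sup>(\<^sup>1\<^sup>), \<dots>, r\<^sup>(\<^sup>m\<^sup>+\<^sup>1\<^sup>)]\<close>.\<close>

fun iter_comul :: "('k, 'c) rack_data \<Rightarrow> nat \<Rightarrow> 'c \<Rightarrow> 'c list list" where
  "iter_comul C 0 r = [[r]]"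
| "iter_comul C (Suc m) r = [a # cs. (a, b) \<leftarrow> comul C r, cs \<leftarrow> iter_comul C m b]"

text \<open>
  The convention for the empty list is the unit map from the ground field to \<open>C\<close>;
  it makes degree \<open>0\<close> meaningful, where the coderivations are the primitive elements.
\<close>

fun rack_mu :: "('k, 'c) rack_data \<Rightarrow> 'c list \<Rightarrow> 'c" where
  "rack_mu C [] = gunit C"
| "rack_mu C (r # rs) = foldl (rack C) r rs"

definition Coder :: "('k::field, 'c::ab_group_add) rack_data \<Rightarrow> nat \<Rightarrow> ('c list \<Rightarrow> 'c) set" where
  "Coder C n = {\<omega> \<in> tensor_hom (scl C) (scl C) n. \<forall>rs. length rs = n \<longrightarrow>
     tensor_eq2 (scl C) (comul C (\<omega> rs))
       ([(\<omega> as, rack_mu C bs). (as, bs) \<leftarrow> tensor_comul C rs] @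
        [(rack_mu C as, \<omega> bs). (as, bs) \<leftarrow> tensor_comul C rs])}"

text \<open>
  In the three operators below, the list \<open>[r\<^sub>1, \<dots>, r\<^sub>n\<^sub>+\<^sub>1]\<close> and the index \<open>i\<close> are counted
  from \<open>1\<close>.
\<close>

definition face1 ::
  "('k, 'c::ab_group_add) rack_data \<Rightarrow> nat \<Rightarrow> ('c list \<Rightarrow> 'c) \<Rightarrow> 'c list \<Rightarrow> 'c"
where
  "face1 C i \<omega> rs = (\<Sum>(as, bs)\<leftarrow>tensor_comul C (drop i rs).
     rack C (\<omega> (take (i - 1) rs @ as)) (rack_mu C (rs ! (i - 1) # bs)))"

text \<open>This one is used for \<open>i \<ge> 2\<close> only, where \<open>r\<^sub>i\<close> is split into \<open>i - 1 \<ge> 1\<close> factors.\<close>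

definition face0 ::
  "('k, 'c::ab_group_add) rack_data \<Rightarrow> nat \<Rightarrow> ('c list \<Rightarrow> 'c) \<Rightarrow> 'c list \<Rightarrow> 'c"
where
  "face0 C i \<omega> rs = (\<Sum>cs\<leftarrow>iter_comul C (i - 2) (rs ! (i - 1)).
     \<omega> (map2 (rack C) (take (i - 1) rs) cs @ drop i rs))"

text \<open>For \<open>n = 0\<close>, where there is no \<open>r\<^sub>2\<close>, this reads \<open>rack C r\<^sub>1 (\<omega> [])\<close>.\<close>

definition face_last ::
  "('k, 'c::ab_group_add) rack_data \<Rightarrow> ('c list \<Rightarrow> 'c) \<Rightarrow> 'c list \<Rightarrow> 'c"
where
  "face_last C \<omega> rs = (\<Sum>(as, bs)\<leftarrow>tensor_comul C (drop 2 rs).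
     rack C (rack_mu C (hd rs # as)) (\<omega> (take 1 (tl rs) @ bs)))"

text \<open>
  The summation index \<open>i\<close> counts the acting argument from the right: the \<open>i\<close>-th summand lets
  \<open>r\<^sub>j\<close> with \<open>j = n + 2 - i\<close> act on the arguments to its left, and \<open>j\<close> runs from \<open>n + 1\<close> down
  to \<open>2\<close>. With \<open>j = i\<close> instead (so that \<open>r\<^sub>1\<close> would act and \<open>r\<^sub>n\<^sub>+\<^sub>1\<close> would not) the operator does
  not square to zero in general.
\<close>

definition deform_diff ::
  "('k::field, 'c::ab_group_add) rack_data \<Rightarrow> nat \<Rightarrow> ('c list \<Rightarrow> 'c) \<Rightarrow> 'c list \<Rightarrow> 'c"
where
  "deform_diff C n \<omega> rs = (if length rs = n + 1 then
     (\<Sum>i=1..n. scl C ((-1) ^ (i + 1)) (face1 C (n + 2 - i) \<omega> rs - face0 C (n + 2 - i) \<omega> rs))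
       + scl C ((-1) ^ (n + 1)) (face_last C \<omega> rs)
     else 0)"

section \<open>Right Leibniz algebras and Leibniz cohomology\<close>

locale leibniz_algebra = vector_space s
  for s :: "'k::field \<Rightarrow> 'h::ab_group_add \<Rightarrow> 'h" +
  fixes bracket :: "'h \<Rightarrow> 'h \<Rightarrow> 'h"
  assumes linear_left: "Vector_Spaces.linear s s (\<lambda>x. bracket x y)"
    and linear_right: "Vector_Spaces.linear s s (\<lambda>y. bracket x y)"
    and leibniz: "bracket (bracket x y) z = bracket (bracket x z) y + bracket x (bracket y z)"

definition leibniz_diff ::
  "('k::field \<Rightarrow> 'h::ab_group_add \<Rightarrow> 'h) \<Rightarrow> ('h \<Rightarrow> 'h \<Rightarrow> 'h) \<Rightarrow> nat \<Rightarrow> ('h list \<Rightarrow> 'h) \<Rightarrow> 'h list \<Rightarrow> 'h"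
where
  "leibniz_diff s bracket n f xs = (if length xs = n + 1 then
     bracket (xs ! 0) (f (drop 1 xs))
     + (\<Sum>i=2..n+1. s ((-1) ^ i) (bracket (f (take (i - 1) xs @ drop i xs)) (xs ! (i - 1))))
     + (\<Sum>j=1..n+1. \<Sum>i=1..<j. s ((-1) ^ (j + 1))
          (f (take (j - 1) (xs[i - 1 := bracket (xs ! (i - 1)) (xs ! (j - 1))]) @ drop j xs)))
     else 0)"

section \<open>The rack bialgebra of a Leibniz algebra\<close>

text \<open>
  The pair \<open>(l, x)\<close> stands for \<open>l\<cdot>1 + x\<close>; the formulas are the linear extensions of
  those for \<open>1\<close> and for \<open>x\<close> in the Leibniz algebra.
\<close>

definition leibniz_rack ::
  "('k::field \<Rightarrow> 'h::ab_group_add \<Rightarrow> 'h) \<Rightarrow> ('h \<Rightarrow> 'h \<Rightarrow> 'h) \<Rightarrow> ('k, 'k \<times> 'h) rack_data"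
where
  "leibniz_rack s bracket =
    \<lparr> scl = module_prod.scale (*) s,
      comul = (\<lambda>(l, x). [((l, 0), (1, 0)), ((1, 0), (0, x)), ((0, x), (1, 0))]),
      counit = fst,
      gunit = (1, 0),
      rack = (\<lambda>(l, x) (m, y). (l * m, s m x + bracket x y)) \<rparr>"

lemma module_poly_mapping: "module (\<lambda>c::'k::field. Poly_Mapping.map ((*) c) :: ('a \<Rightarrow>\<^sub>0 'k) \<Rightarrow> _)"
proof -
  have l: "Poly_Mapping.lookup (Poly_Mapping.map ((*) c) p) x = c * Poly_Mapping.lookup p x"
    for c :: 'k and p :: "'a \<Rightarrow>\<^sub>0 'k" and x
    by (simp add: Poly_Mapping.map.rep_eq when_def)
  show ?thesis
    by unfold_locales (auto intro!: poly_mapping_eqI simp: l lookup_add algebra_simps)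
qed

locale tensor_calculus = vector_space s for s :: "'k::field \<Rightarrow> 'c::ab_group_add \<Rightarrow> 'c"
begin

interpretation P: module "\<lambda>c::'k. Poly_Mapping.map ((*) c) :: ('c list \<Rightarrow>\<^sub>0 'k) \<Rightarrow> _"
  by (rule module_poly_mapping)

definition R where "R = P.span (tensor_rel s)"

abbreviation e where "e xs \<equiv> Poly_Mapping.single (xs :: 'c list) (1::'k)"

lemma R_add: "p \<in> R \<Longrightarrow> q \<in> R \<Longrightarrow> p + q \<in> R" unfolding R_def by (rule P.span_add)
lemma R_diff: "p \<in> R \<Longrightarrow> q \<in> R \<Longrightarrow> p - q \<in> R" unfolding R_def by (rule P.span_diff)

lemma rel_add: "e (xs @ (a + b) # ys) - e (xs @ a # ys) - e (xs @ b # ys) \<in> R"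
  unfolding R_def by (rule P.span_base) (auto simp: tensor_rel_def)

lemma rel_scale: "e (xs @ s c a # ys) - Poly_Mapping.single (xs @ a # ys) c \<in> R"
  unfolding R_def by (rule P.span_base) (unfold tensor_rel_def, blast)

lemma rel_zero: "e (xs @ 0 # ys) \<in> R"
  using rel_scale[of xs 0 0 ys] by simp

lemma rel_move: "e (xs @ s c a # ys @ b # zs) - e (xs @ a # ys @ s c b # zs) \<in> R"
  using R_diff[OF rel_scale[of xs c a "ys @ b # zs"] rel_scale[of "xs @ a # ys" c b zs]] by simp

lemma rel_swap: "p - q \<in> R \<Longrightarrow> q - p \<in> R"
  using R_diff[of 0 "p - q"] R_def P.span_zero by simp

lemma tensor_eq_iff: "tensor_eq s S T \<longleftrightarrow> formal_sum S - formal_sum T \<in> R"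
  by (simp add: tensor_eq_def R_def)

end

lemma
  fixes s :: "'k::field \<Rightarrow> 'h::ab_group_add \<Rightarrow> 'h"
  assumes "leibniz_algebra s bracket"
  shows rack_bialgebra_leibniz_rack: "rack_bialgebra (leibniz_rack s bracket)" (is ?rack)
    and cocommutative_leibniz_rack: "cocommutative (leibniz_rack s bracket)" (is ?cocomm)
proof -
  interpret leibniz_algebra s bracket by fact
  interpret pr: vector_space_prod "(*) :: 'k \<Rightarrow> 'k \<Rightarrow> 'k" s
    by (intro vector_space_prod.intro vector_space_pair.intro vector_space_axioms)
      (unfold_locales; simp add: algebra_simps)
  interpret T: tensor_calculus "module_prod.scale (*) s"
    by (intro tensor_calculus.intro pr.p.vector_space_axioms)
  interpret bl: Vector_Spaces.linear s s "\<lambda>x. bracket x y" for y by (rule linear_left)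
  interpret br: Vector_Spaces.linear s s "\<lambda>y. bracket x y" for x by (rule linear_right)
  note zero = T.rel_zero[of "[]"] T.rel_zero[of "[x]" for x] T.rel_zero[of "[x, y]" for x y]
  note zero = zero[simplified, unfolded zero_prod_def]
  note add1 = T.rel_add[of "[]" _ _ "[y]" for y, simplified]
  note add2 = T.rel_add[of "[x]" _ _ "[]" for x, simplified]
  note move = T.rel_move[of "[]" _ _ "[]" _ "[]", simplified]
  note move' = move[THEN T.rel_swap]
  note defs = leibniz_rack_def tensor_eq2_def T.tensor_eq_iff formal_sum_def pr.scale_def
  let ?C = "leibniz_rack s bracket"
  show ?rack
  proof (rule rack_bialgebra.intro)
    show "vector_space (scl ?C)"
      by (simp add: leibniz_rack_def pr.p.vector_space_axioms)
  next
    fix x y :: "'k \<times> 'h"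
    obtain l x' m y' where [simp]: "x = (l, x')" "y = (m, y')" by fastforce
    show "tensor_eq2 (scl ?C) (comul ?C (x + y))
        (comul ?C x @ comul ?C y)"
      using T.R_add[OF T.R_add[OF add1[of "(l, 0)" "(m, 0)" "(1, 0)"] add1[of "(0, x')" "(0, y')" "(1, 0)"]]
          add2[of "(1, 0)" "(0, x')" "(0, y')"]]
      by (simp add: defs algebra_simps)
  next
    fix c :: 'k and x :: "'k \<times> 'h"
    obtain l x' where [simp]: "x = (l, x')" by fastforce
    show "tensor_eq2 (scl ?C)
        (comul ?C (scl ?C c x))
        [(scl ?C c a, b). (a, b) \<leftarrow> comul ?C x]"
      using move'[of "(1, 0)" c "(0, x')"] by (simp add: defs algebra_simps)
  next
    show "Vector_Spaces.linear (scl ?C) (*) (counit ?C)"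
      using pr.linear_fst by (simp add: leibniz_rack_def)
  next
    fix x :: "'k \<times> 'h"
    obtain l x' where [simp]: "x = (l, x')" by fastforce
    let ?U = "(1, 0) :: 'k \<times> 'h" and ?L = "(l, 0) :: 'k \<times> 'h" and ?X = "(0, x') :: 'k \<times> 'h"
      and ?Z = "(0, 0) :: 'k \<times> 'h"
    have "(T.e [?Z, ?U, ?U] + T.e [?U, ?Z, ?X] + T.e [?Z, ?U, ?X] + T.e [?Z, ?U, ?U])
        - (T.e [?L, ?U, ?Z] + T.e [?L, ?Z, ?U] + T.e [?X, ?U, ?Z] + T.e [?X, ?Z, ?U]) \<in> T.R"
      by (intro T.R_add T.R_diff zero)
    then show "tensor_eq (scl ?C)
        [[a1, a2, b]. (a, b) \<leftarrow> comul ?C x, (a1, a2) \<leftarrow> comul ?C a]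
        [[a, b1, b2]. (a, b) \<leftarrow> comul ?C x, (b1, b2) \<leftarrow> comul ?C b]"
      by (simp add: defs algebra_simps)
  next
    fix x :: "'k \<times> 'h"
    show "(\<Sum>(a, b)\<leftarrow>comul ?C x.
        scl ?C (counit ?C a) b) = x"
      by (simp add: defs split: prod.splits)
  next
    fix x :: "'k \<times> 'h"
    show "(\<Sum>(a, b)\<leftarrow>comul ?C x.
        scl ?C (counit ?C b) a) = x"
      by (simp add: defs split: prod.splits)
  next
    show "tensor_eq2 (scl ?C)
        (comul ?C (gunit ?C))
        [(gunit ?C, gunit ?C)]"
      by (simp add: defs T.R_add zero)
  next
    show "counit ?C (gunit ?C) = 1"
      by (simp add: defs)
  next
    fix y :: "'k \<times> 'h"
    show "Vector_Spaces.linear (scl ?C) (scl ?C)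
        (\<lambda>x. rack ?C x y)"
      using pr.p.vector_space_axioms
      by (simp add: Vector_Spaces.linear_iff leibniz_rack_def pr.scale_def split_beta)
        (simp add: bl.add bl.scale scale_right_distrib distrib_right)
  next
    fix x :: "'k \<times> 'h"
    show "Vector_Spaces.linear (scl ?C) (scl ?C)
        (rack ?C x)"
      using pr.p.vector_space_axioms
      by (simp add: Vector_Spaces.linear_iff leibniz_rack_def pr.scale_def split_beta)
        (simp add: br.add br.scale scale_left_distrib scale_right_distrib distrib_left)
  next
    fix x y :: "'k \<times> 'h"
    obtain l x' m y' where [simp]: "x = (l, x')" "y = (m, y')" by fastforce
    let ?U = "(1, 0) :: 'k \<times> 'h" and ?X = "(0, x') :: 'k \<times> 'h"
    let ?L = "(l, 0) :: 'k \<times> 'h" and ?Z = "(0, 0) :: 'k \<times> 'h"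
    have "(T.e [?U, (0, s m x') + (0, bracket x' y')] - T.e [?U, (0, s m x')] - T.e [?U, (0, bracket x' y')])
       + (T.e [(0, s m x') + (0, bracket x' y'), ?U] - T.e [(0, s m x'), ?U] - T.e [(0, bracket x' y'), ?U])
       + (T.e [?U, pr.scale m ?X] - T.e [pr.scale m ?U, ?X])
       - T.e [?L, ?Z] - T.e [?Z, ?U] - T.e [?Z, ?X] - T.e [?X, ?Z] \<in> T.R"
      by (intro T.R_add T.R_diff[of _ "T.e xs" for xs] zero add1 add2 move')
    then show "tensor_eq2 (scl ?C)
        (comul ?C (rack ?C x y))
        [(rack ?C a c, rack ?C b d).
          (a, b) \<leftarrow> comul ?C x, (c, d) \<leftarrow> comul ?C y]"
      by (simp add: defs bl.zero br.zero algebra_simps)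
  next
    fix x y :: "'k \<times> 'h"
    show "counit ?C (rack ?C x y) =
        counit ?C x * counit ?C y"
      by (simp add: defs split: prod.splits)
  next
    fix x y z :: "'k \<times> 'h"
    obtain l x' m y' n z' where [simp]: "x = (l, x')" "y = (m, y')" "z = (n, z')" by fastforce
    show "rack ?C (rack ?C x y) z =
        (\<Sum>(a, b)\<leftarrow>comul ?C z. rack ?C
          (rack ?C x a) (rack ?C y b))"
      by (simp add: leibniz_rack_def, simp add: bl.add bl.scale br.scale scale_right_distrib,
          simp add: leibniz[of x' y' z'] mult.commute add.commute add.left_commute)
  next
    fix x :: "'k \<times> 'h"
    show "rack ?C x (gunit ?C) = x"
      by (simp add: defs br.zero split: prod.splits)
  next
    fix x :: "'k \<times> 'h"
    show "rack ?C (gunit ?C) x =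
        scl ?C (counit ?C x) (gunit ?C)"
      by (simp add: defs bl.zero split: prod.splits)
  qed
  show ?cocomm
    unfolding cocommutative_def
  proof
    fix x :: "'k \<times> 'h"
    obtain l x' where [simp]: "x = (l, x')" by fastforce
    show "tensor_eq2 (scl ?C) (comul ?C x)
        [(b, a). (a, b) \<leftarrow> comul ?C x]"
      using move[of l "(1, 0)" "(1, 0)"] by (simp add: defs algebra_simps)
  qed
qed

section \<open>Embeddings of cochain complexes\<close>

definition cochain_embedding ::
  "('k::field \<Rightarrow> 'v::ab_group_add \<Rightarrow> 'v) \<Rightarrow> (nat \<Rightarrow> ('a list \<Rightarrow> 'v) set)
    \<Rightarrow> (nat \<Rightarrow> ('a list \<Rightarrow> 'v) \<Rightarrow> 'a list \<Rightarrow> 'v)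
    \<Rightarrow> ('k \<Rightarrow> 'w::ab_group_add \<Rightarrow> 'w) \<Rightarrow> (nat \<Rightarrow> ('b list \<Rightarrow> 'w) set)
    \<Rightarrow> (nat \<Rightarrow> ('b list \<Rightarrow> 'w) \<Rightarrow> 'b list \<Rightarrow> 'w)
    \<Rightarrow> (nat \<Rightarrow> ('a list \<Rightarrow> 'v) \<Rightarrow> 'b list \<Rightarrow> 'w) \<Rightarrow> bool"
where
  "cochain_embedding sA A dA sB B dB \<Phi> \<longleftrightarrow> (\<forall>n.
     \<Phi> n ` A n \<subseteq> B n \<and>
     (\<forall>f\<in>A n. \<forall>g\<in>A n. \<Phi> n (\<lambda>xs. f xs + g xs) = (\<lambda>rs. \<Phi> n f rs + \<Phi> n g rs)) \<and>
     (\<forall>c. \<forall>f\<in>A n. \<Phi> n (\<lambda>xs. sA c (f xs)) = (\<lambda>rs. sB c (\<Phi> n f rs))) \<and>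
     inj_on (\<Phi> n) (A n) \<and>
     (\<forall>f\<in>A n. \<Phi> (Suc n) (dA n f) = dB n (\<Phi> n f)))"

end

theory Submission
  imports Defs
begin

text \<open>
  A Leibniz cochain, extended by zero to tensors with a factor \<open>1\<close>, is a coderivation. In the
  deformation differential of this extension, \<open>1\<close> acts trivially both in \<open>d\<^sub>i\<^sub>,\<^sub>1\<close> and in
  \<open>d\<^sub>i\<^sub>,\<^sub>0\<close>, so these contributions cancel, and what remains on \<open>\<hh>\<close> is, up to a global sign,
  the Leibniz differential.
\<close>

section \<open>Sums and multilinear maps on lists\<close>

lemma sum_list_mem:
  assumes "0 \<in> N" "\<And>p q. p \<in> N \<Longrightarrow> q \<in> N \<Longrightarrow> p + q \<in> N" "\<And>x. x \<in> set xs \<Longrightarrow> F x \<in> N"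
  shows "(\<Sum>x\<leftarrow>xs. F x) \<in> (N :: 'a::monoid_add set)"
  using assms(3) by (induction xs) (auto intro: assms(1,2))

lemma sum_list_Pair: "(\<Sum>x\<leftarrow>xs. (0, f x)) = (0, \<Sum>x\<leftarrow>xs. f x)"
  by (induction xs) (auto simp: zero_prod_def)

lemma tensor_hom_linear:
  assumes "f \<in> tensor_hom s1 s2 n" "length xs + length ys + 1 = n"
  shows "Vector_Spaces.linear s1 s2 (\<lambda>a. f (xs @ a # ys))"
proof -
  have "Vector_Spaces.linear s1 s2 (\<lambda>a. f (zs[i := a]))" if "length zs = n" "i < n" for zs i
    using assms(1) that by (simp add: tensor_hom_def)
  from this[of "xs @ 0 # ys" "length xs"] show ?thesis using assms(2) by simp
qed

lemma tensor_hom_zero: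
  assumes "f \<in> tensor_hom s1 s2 n" "0 \<in> set xs"
  shows "f xs = 0"
proof (cases "length xs = n")
  case True
  obtain ys zs where xs: "xs = ys @ 0 # zs" using assms(2) by (meson split_list)
  then interpret Vector_Spaces.linear s1 s2 "\<lambda>a. f (ys @ a # zs)"
    using True by (intro tensor_hom_linear[OF assms(1)]) auto
  show ?thesis using zero xs by simp
next
  case False
  then show ?thesis using assms(1) by (auto simp: tensor_hom_def)
qed

lemma tensor_hom_scale:
  assumes "vector_space s2" "f \<in> tensor_hom s1 s2 n"
  shows "(\<lambda>xs. s2 c (f xs)) \<in> tensor_hom s1 s2 n"
proof -
  interpret vector_space s2 by fact
  show ?thesis using assms(2)
    by (auto simp: tensor_hom_def Vector_Spaces.linear_iff scale_right_distrib mult.commute)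
qed

section \<open>The associated rack bialgebra in coordinates\<close>

context leibniz_algebra
begin

abbreviation "C \<equiv> leibniz_rack s bracket"

text \<open>The unit \<open>(1, 0)\<close> has second component 0, so discarding scalar parts by
  \<open>snd\<close> extends a multilinear \<open>f\<close> by zero.\<close>

definition lift_cochain :: "('h list \<Rightarrow> 'h) \<Rightarrow> ('k \<times> 'h) list \<Rightarrow> 'k \<times> 'h" where
  "lift_cochain f rs = (0, f (map snd rs))"

interpretation pr: vector_space_prod "(*) :: 'k \<Rightarrow> 'k \<Rightarrow> 'k" s
  by (intro vector_space_prod.intro vector_space_pair.intro vector_space_axioms)
    (unfold_locales; simp add: algebra_simps)
interpretation T: tensor_calculus "module_prod.scale (*) s"
  by (intro tensor_calculus.intro pr.p.vector_space_axioms)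
interpretation bl: Vector_Spaces.linear s s "\<lambda>x. bracket x y" for y by (rule linear_left)
interpretation br: Vector_Spaces.linear s s "\<lambda>y. bracket x y" for x by (rule linear_right)

lemma scl_C: "scl C c r = (c * fst r, s c (snd r))"
  by (cases r) (simp add: leibniz_rack_def pr.scale_def)

lemma rack_C: "rack C r t = (fst r * fst t, s (fst t) (snd r) + bracket (snd r) (snd t))"
  by (simp add: leibniz_rack_def split: prod.splits)

lemma comul_C: "comul C r = [((fst r, 0), (1, 0)), ((1, 0), (0, snd r)), ((0, snd r), (1, 0))]"
  by (simp add: leibniz_rack_def split: prod.splits)

lemma foldl_rack_unit: "foldl (rack C) r (replicate m (1, 0)) = r"
  by (induction m) (auto simp: rack_C br.zero)

lemma rack_mu_unit: "rack_mu C (replicate m (1, 0)) = (1, 0)"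
  by (cases m) (auto simp: foldl_rack_unit, simp add: leibniz_rack_def)

section \<open>Collapse of the coproduct of a pure tensor\<close>

text \<open>
  Of the coproduct of a pure tensor only the summand with all factors in \<open>\<hh>\<close> on one side
  survives, since every other one has a factor without component in \<open>\<hh>\<close> on that side.
\<close>

lemma sum_tensor_comul_left:
  fixes F :: "('k \<times> 'h) list \<Rightarrow> ('k \<times> 'h) list \<Rightarrow> 'a::ab_group_add"
  assumes N: "0 \<in> N" "\<And>p q. p \<in> N \<Longrightarrow> q \<in> N \<Longrightarrow> p + q \<in> N"
    and F: "\<And>as bs. 0 \<in> snd ` set as \<Longrightarrow> F as bs \<in> N"
  shows "(\<Sum>(as, bs)\<leftarrow>tensor_comul C rs. F as bs)
      - F (map (\<lambda>r. (0, snd r)) rs) (replicate (length rs) (1, 0)) \<in> N"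
  using F
proof (induction rs arbitrary: F)
  case Nil
  then show ?case using N by simp
next
  case (Cons r rs)
  \<comment> \<open>One fact per summand of \<open>comul C r\<close>: in the first two the left
    factor is a multiple of 1, which puts every term in \<open>N\<close>; the third falls to the
    induction hypothesis.\<close>
  have 1: "(\<Sum>(as, bs)\<leftarrow>tensor_comul C rs. F ((fst r, 0) # as) ((1, 0) # bs)) \<in> N"
    by (rule sum_list_mem) (auto intro!: N Cons.prems)
  have 2: "(\<Sum>(as, bs)\<leftarrow>tensor_comul C rs. F ((1, 0) # as) ((0, snd r) # bs)) \<in> N"
    by (rule sum_list_mem) (auto intro!: N Cons.prems)
  have 3: "(\<Sum>(as, bs)\<leftarrow>tensor_comul C rs. F ((0, snd r) # as) ((1, 0) # bs))
      - F ((0, snd r) # map (\<lambda>r. (0, snd r)) rs) ((1, 0) # replicate (length rs) (1, 0)) \<in> N"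
    by (rule Cons.IH[of "\<lambda>as bs. F ((0, snd r) # as) ((1, 0) # bs)"]) (auto intro!: Cons.prems)
  show ?case using N(2)[OF N(2)[OF 1 2] 3]
    by (simp add: comul_C o_def case_prod_unfold algebra_simps)
qed

lemma sum_tensor_comul_right:
  fixes F :: "('k \<times> 'h) list \<Rightarrow> ('k \<times> 'h) list \<Rightarrow> 'a::ab_group_add"
  assumes N: "0 \<in> N" "\<And>p q. p \<in> N \<Longrightarrow> q \<in> N \<Longrightarrow> p + q \<in> N"
    and F: "\<And>as bs. 0 \<in> snd ` set bs \<Longrightarrow> F as bs \<in> N"
  shows "(\<Sum>(as, bs)\<leftarrow>tensor_comul C rs. F as bs)
      - F (replicate (length rs) (1, 0)) (map (\<lambda>r. (0, snd r)) rs) \<in> N"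
  using F
proof (induction rs arbitrary: F)
  case Nil
  then show ?case using N by simp
next
  case (Cons r rs)
  have 1: "(\<Sum>(as, bs)\<leftarrow>tensor_comul C rs. F ((fst r, 0) # as) ((1, 0) # bs)) \<in> N"
    by (rule sum_list_mem) (auto intro!: N Cons.prems)
  have 2: "(\<Sum>(as, bs)\<leftarrow>tensor_comul C rs. F ((0, snd r) # as) ((1, 0) # bs)) \<in> N"
    by (rule sum_list_mem) (auto intro!: N Cons.prems)
  have 3: "(\<Sum>(as, bs)\<leftarrow>tensor_comul C rs. F ((1, 0) # as) ((0, snd r) # bs))
      - F ((1, 0) # replicate (length rs) (1, 0)) ((0, snd r) # map (\<lambda>r. (0, snd r)) rs) \<in> N"
    by (rule Cons.IH[of "\<lambda>as bs. F ((1, 0) # as) ((0, snd r) # bs)"]) (auto intro!: Cons.prems)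
  show ?case using N(2)[OF N(2)[OF 1 2] 3]
    by (simp add: comul_C o_def case_prod_unfold algebra_simps)
qed

section \<open>Lifted cochains as coderivations\<close>

lemma lift_cochain_zero:
  assumes "f \<in> tensor_hom s s n" "0 \<in> snd ` set rs"
  shows "lift_cochain f rs = 0"
  using tensor_hom_zero[OF assms(1), of "map snd rs"] assms(2)
  by (simp add: lift_cochain_def zero_prod_def)

lemma lift_cochain_snd: "lift_cochain f (map (\<lambda>r. (0, snd r)) rs) = lift_cochain f rs"
  by (simp add: lift_cochain_def o_def)

lemma lift_cochain_tensor_hom:
  assumes "f \<in> tensor_hom s s n"
  shows "lift_cochain f \<in> tensor_hom (scl C) (scl C) n"
proof -
  have "Vector_Spaces.linear (scl C) (scl C) (\<lambda>a. lift_cochain f (rs[i := a]))"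
    if "length rs = n" "i < n" for rs i
  proof -
    interpret Vector_Spaces.linear s s "\<lambda>a. f ((map snd rs)[i := a])"
      using assms that by (auto simp: tensor_hom_def)
    have "vector_space (scl C)"
      by (simp add: leibniz_rack_def pr.p.vector_space_axioms)
    then show ?thesis
      by (simp add: Vector_Spaces.linear_iff lift_cochain_def scl_C map_update add scale)
  qed
  then show ?thesis
    using assms by (auto simp: tensor_hom_def lift_cochain_def zero_prod_def)
qed

text \<open>Values of the lift have scalar part 0, hence are primitive. The two sums of the
  coderivation condition collapse to the two terms of the coproduct of such a value, because
  \<open>rack_mu\<close> of a list of units is the unit.\<close>

lemma lift_cochain_Coder:
  assumes f: "f \<in> tensor_hom s s n"
  shows "lift_cochain f \<in> Coder C n"
proof -
  have "tensor_eq2 (scl C) (comul C (lift_cochain f rs))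
       ([(lift_cochain f as, rack_mu C bs). (as, bs) \<leftarrow> tensor_comul C rs] @
        [(rack_mu C as, lift_cochain f bs). (as, bs) \<leftarrow> tensor_comul C rs])" for rs
  proof -
    let ?U = "(1, 0) :: 'k \<times> 'h"
    have 0: "0 \<in> T.R" by (metis T.R_diff T.rel_zero diff_self)
    \<comment> \<open>The collapse is taken modulo \<open>N = T.R\<close>, that is, as tensors; for
      the faces below, \<open>N = {0}\<close> gives equality in \<open>C\<close>.\<close>
    have 1: "(\<Sum>(as, bs)\<leftarrow>tensor_comul C rs. T.e [lift_cochain f as, rack_mu C bs])
        - T.e [lift_cochain f rs, ?U] \<in> T.R"
      using sum_tensor_comul_left[of T.R "\<lambda>as bs. T.e [lift_cochain f as, rack_mu C bs]" rs,
          OF 0 T.R_add] T.rel_zero[of "[]"]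
      by (simp add: lift_cochain_zero[OF f] lift_cochain_snd rack_mu_unit)
    have 2: "(\<Sum>(as, bs)\<leftarrow>tensor_comul C rs. T.e [rack_mu C as, lift_cochain f bs])
        - T.e [?U, lift_cochain f rs] \<in> T.R"
      using sum_tensor_comul_right[of T.R "\<lambda>as bs. T.e [rack_mu C as, lift_cochain f bs]" rs,
          OF 0 T.R_add] T.rel_zero[of "[a]" "[]" for a]
      by (simp add: lift_cochain_zero[OF f] lift_cochain_snd rack_mu_unit)
    \<comment> \<open>The first formal summand of \<open>comul C\<close> at a value of the lift; it
      vanishes only modulo the relations.\<close>
    have 3: "T.e [(0, 0), ?U] \<in> T.R" using T.rel_zero[of "[]" "[?U]"] by (simp add: zero_prod_def)
    have scl: "scl C = pr.scale" by (simp add: leibniz_rack_def)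
    show ?thesis
      using T.R_diff[OF T.R_diff[OF 3 1] 2]
      by (simp add: scl tensor_eq2_def T.tensor_eq_iff formal_sum_def comul_C o_def case_prod_unfold
          map_concat algebra_simps) (simp add: lift_cochain_def algebra_simps)
  qed
  then show ?thesis using lift_cochain_tensor_hom[OF f] by (simp add: Coder_def)
qed

section \<open>The faces of a lifted cochain\<close>

text \<open>Once the later arguments put their second components into the cochain, only units are
  left for \<open>rack_mu\<close>, and these fix \<open>rs ! (i - 1)\<close>.\<close>

lemma face1_lift:
  assumes f: "f \<in> tensor_hom s s n"
  shows "face1 C i (lift_cochain f) rs =
    rack C (lift_cochain f (take (i - 1) rs @ drop i rs)) (rs ! (i - 1))"
proof -
  have z: "rack C (lift_cochain f (pre @ as)) t = 0" if "0 \<in> snd ` set as" for pre as t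
    using that by (subst lift_cochain_zero[OF f]) (auto simp: rack_C bl.zero zero_prod_def)
  have "face1 C i (lift_cochain f) rs
      - rack C (lift_cochain f (take (i - 1) rs @ map (\<lambda>r. (0, snd r)) (drop i rs))) (rs ! (i - 1)) \<in> {0}"
    using sum_tensor_comul_left[of "{0}"
        "\<lambda>as bs. rack C (lift_cochain f (take (i - 1) rs @ as)) (rack_mu C (rs ! (i - 1) # bs))" "drop i rs"]
    by (simp add: z face1_def foldl_rack_unit)
  then show ?thesis by (simp add: lift_cochain_def o_def)
qed

text \<open>Mirror image: the cochain now sits in the right factor, and the units act on
  \<open>hd rs\<close>.\<close>

lemma face_last_lift:
  assumes f: "f \<in> tensor_hom s s n"
  shows "face_last C (lift_cochain f) rs = rack C (hd rs) (lift_cochain f (tl rs))"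
proof -
  have z: "rack C t (lift_cochain f (pre @ bs)) = 0" if "0 \<in> snd ` set bs" for pre bs t
    using that by (subst lift_cochain_zero[OF f]) (auto simp: rack_C br.zero zero_prod_def)
  have "face_last C (lift_cochain f) rs
      - rack C (hd rs) (lift_cochain f (take 1 (tl rs) @ map (\<lambda>r. (0, snd r)) (drop 2 rs))) \<in> {0}"
    using sum_tensor_comul_right[of "{0}"
        "\<lambda>as bs. rack C (rack_mu C (hd rs # as)) (lift_cochain f (take 1 (tl rs) @ bs))" "drop 2 rs"]
    by (simp add: z face_last_def foldl_rack_unit)
  moreover have "map snd (take 1 (tl rs)) @ map snd (drop 2 rs) = map snd (tl rs)"
    by (metis append_take_drop_id drop_Suc map_append numeral_2_eq_2 One_nat_def)
  ultimately show ?thesis by (simp add: lift_cochain_def o_def)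
qed

text \<open>The iterated coproduct puts a primitive element in one slot and 1 in the others, so it
  acts as a derivation; the scalar part of \<open>r\<close> just multiplies. The function under
  \<open>map2\<close> is the second component of \<open>rack C\<close>. A free \<open>pre\<close>
  lets the induction absorb the head of \<open>ys\<close>.\<close>

lemma sum_iter_comul:
  assumes f: "f \<in> tensor_hom s s n"
    and "length ys = Suc m" "length pre + length ys + length zs = n"
  shows "(\<Sum>cs\<leftarrow>iter_comul C m r.
        f (pre @ map2 (\<lambda>y c. s (fst c) y + bracket y (snd c)) ys cs @ zs)) =
    s (fst r) (f (pre @ ys @ zs)) + (\<Sum>a<Suc m. f (pre @ ys[a := bracket (ys ! a) (snd r)] @ zs))"
  using assms(2-)
proof (induction m arbitrary: r ys pre)
  case 0
  then obtain y where y: "ys = [y]" by (auto simp: length_Suc_conv)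
  interpret Vector_Spaces.linear s s "\<lambda>a. f (pre @ a # zs)"
    using 0 y by (intro tensor_hom_linear[OF f]) auto
  show ?case by (simp add: y add scale)
next
  case (Suc m)
  then obtain y ys' where y: "ys = y # ys'" "length ys' = Suc m" by (auto simp: length_Suc_conv)
  interpret Vector_Spaces.linear s s "\<lambda>a. f (pre @ a # ys' @ zs)"
    using Suc y by (intro tensor_hom_linear[OF f]) auto
  \<comment> \<open>Kills the brackets with 0 that arise from the two summands of
    \<open>comul C r\<close> with right factor 1.\<close>
  have z: "f (pre @ v # ys'[a := 0] @ zs) = 0" if "a < Suc m" for v a
    using that y by (intro tensor_hom_zero[OF f]) (auto simp: set_update_memI)
  have IH: "(\<Sum>cs\<leftarrow>iter_comul C m r.
        f (pre @ v # map2 (\<lambda>y c. s (fst c) y + bracket y (snd c)) ys' cs @ zs)) =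
    s (fst r) (f (pre @ v # ys' @ zs)) + (\<Sum>a<Suc m. f (pre @ v # ys'[a := bracket (ys' ! a) (snd r)] @ zs))"
    for v r
    using Suc.IH[of ys' "pre @ [v]" r] Suc.prems y by simp
  show ?case
    using z by (simp add: comul_C o_def y IH br.zero scale sum.lessThan_Suc_shift del: sum.lessThan_Suc)
qed

lemma face0_lift:
  assumes f: "f \<in> tensor_hom s s n" and "length rs = n + 1" "2 \<le> i" "i \<le> n + 1"
  shows "face0 C i (lift_cochain f) rs =
    (0, s (fst (rs ! (i - 1))) (f (map snd (take (i - 1) rs @ drop i rs)))
      + (\<Sum>a<i - 1. f (take (i - 1) ((map snd rs)[a := bracket (snd (rs ! a)) (snd (rs ! (i - 1)))])
          @ drop i (map snd rs))))"
proof -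
  let ?r = "rs ! (i - 1)" and ?ys = "take (i - 1) (map snd rs)" and ?zs = "drop i (map snd rs)"
  have snd_map2: "map snd (map2 (rack C) rs' cs) =
      map2 (\<lambda>y c. s (fst c) y + bracket y (snd c)) (map snd rs') cs" for rs' cs
    by (auto simp: rack_C list_eq_iff_nth_eq)
  \<comment> \<open>\<open>iter_comul C (i - 2)\<close> yields \<open>i - 1\<close> factors, one for
    each argument left of position \<open>i\<close>.\<close>
  have i: "Suc (i - 2) = i - 1" using assms by simp
  have "lift_cochain f (map2 (rack C) (take (i - 1) rs) cs @ drop i rs) =
      (0, f (map2 (\<lambda>y c. s (fst c) y + bracket y (snd c)) ?ys cs @ ?zs))" for cs
    unfolding lift_cochain_def map_append snd_map2 by (simp only: take_map drop_map)
  then have "face0 C i (lift_cochain f) rs = (\<Sum>cs\<leftarrow>iter_comul C (i - 2) ?r.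
      (0, f (map2 (\<lambda>y c. s (fst c) y + bracket y (snd c)) ?ys cs @ ?zs)))"
    by (simp only: face0_def)
  also have "\<dots> = (0, \<Sum>cs\<leftarrow>iter_comul C (i - 2) ?r.
      f (map2 (\<lambda>y c. s (fst c) y + bracket y (snd c)) ?ys cs @ ?zs))"
    by (rule sum_list_Pair)
  also have "\<dots> = (0, s (fst ?r) (f (?ys @ ?zs)) +
      (\<Sum>a<i - 1. f (?ys[a := bracket (?ys ! a) (snd ?r)] @ ?zs)))"
    using sum_iter_comul[OF f, of ?ys "i - 2" "[]" ?zs ?r] assms unfolding i by simp
  also have "(\<Sum>a<i - 1. f (?ys[a := bracket (?ys ! a) (snd ?r)] @ ?zs)) =
      (\<Sum>a<i - 1. f (take (i - 1) ((map snd rs)[a := bracket (snd (rs ! a)) (snd ?r)]) @ ?zs))"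
    using assms by (intro sum.cong) (auto simp: take_update_swap)
  finally show ?thesis by (simp add: take_map drop_map)
qed

section \<open>Comparison of the two differentials\<close>

lemma deform_diff_lift:
  assumes f: "f \<in> tensor_hom s s n"
  shows "deform_diff C n (lift_cochain f) =
    lift_cochain (\<lambda>xs. s ((-1) ^ (n + 1)) (leibniz_diff s bracket n f xs))"
proof
  fix rs
  show "deform_diff C n (lift_cochain f) rs =
      lift_cochain (\<lambda>xs. s ((-1) ^ (n + 1)) (leibniz_diff s bracket n f xs)) rs"
  proof (cases "length rs = n + 1")
    case False
    then show ?thesis by (simp add: deform_diff_def leibniz_diff_def lift_cochain_def zero_prod_def)
  next
    case len: True
    let ?xs = "map snd rs"
    \<comment> \<open>For the argument at position \<open>j\<close>, \<open>A j\<close> is its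
      action on the value of \<open>f\<close> and \<open>B j\<close> its action inside
      \<open>f\<close>: what remains of \<open>face1\<close> and \<open>face0\<close>.\<close>
    define A where "A j = bracket (f (take (j - 1) ?xs @ drop j ?xs)) (?xs ! (j - 1))" for j
    define B where "B j = (\<Sum>i=1..<j.
      f (take (j - 1) (?xs[i - 1 := bracket (?xs ! (i - 1)) (?xs ! (j - 1))]) @ drop j ?xs))" for j
    have B_eq: "B j = (\<Sum>a<j - 1. f (take (j - 1) (?xs[a := bracket (snd (rs ! a)) (snd (rs ! (j - 1)))])
          @ drop j ?xs))" if "2 \<le> j" "j \<le> n + 1" for j
      unfolding B_def using that len
      by (intro sum.reindex_bij_witness[of _ Suc "\<lambda>i. i - 1"]) auto
    \<comment> \<open>Both faces contain the scalar part of \<open>rs ! (j - 1)\<close> times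
      \<open>f\<close> without that argument; it cancels here.\<close>
    have face: "face1 C j (lift_cochain f) rs - face0 C j (lift_cochain f) rs = (0, A j - B j)"
      if "2 \<le> j" "j \<le> n + 1" for j
      using that len
      by (simp add: face1_lift[OF f] face0_lift[OF f] B_eq A_def rack_C lift_cochain_def take_map drop_map)
    \<comment> \<open>Reindexing by \<open>j = n + 2 - i\<close>, the position of the acting
      argument.\<close>
    have "(\<Sum>i=1..n. scl C ((-1) ^ (i + 1))
          (face1 C (n + 2 - i) (lift_cochain f) rs - face0 C (n + 2 - i) (lift_cochain f) rs)) =
        (\<Sum>j=2..n+1. scl C ((-1) ^ (n + 3 - j))
          (face1 C j (lift_cochain f) rs - face0 C j (lift_cochain f) rs))"
      by (rule sum.reindex_bij_witness[of _ "\<lambda>j. n + 2 - j" "\<lambda>i. n + 2 - i"])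
        (auto simp: Suc_diff_le)
    also have "\<dots> = (\<Sum>j=2..n+1. (0, s ((-1) ^ (n + 1)) (s ((-1) ^ j) (A j - B j))))"
    proof (rule sum.cong)
      fix j assume j: "j \<in> {2..n+1}"
      \<comment> \<open>The exponents differ by an even number, so the sign splits into the global
        \<open>(-1) ^ (n + 1)\<close> and the Leibniz sign \<open>(-1) ^ j\<close>.\<close>
      have "n + 1 + j = n + 3 - j + 2 * (j - 1)"
        using j by auto
      then have "(-1 :: 'k) ^ (n + 1 + j) = (-1) ^ (n + 3 - j) * ((-1)\<^sup>2) ^ (j - 1)"
        by (metis power_add power_mult)
      then have sign: "(-1 :: 'k) ^ (n + 3 - j) = (-1) ^ (n + 1) * (-1) ^ j"
        by (simp only: power_add power2_minus one_power2 power_one mult_1_right)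
      have "face1 C j (lift_cochain f) rs - face0 C j (lift_cochain f) rs = (0, A j - B j)"
        using j by (intro face) auto
      then show "scl C ((-1) ^ (n + 3 - j))
          (face1 C j (lift_cochain f) rs - face0 C j (lift_cochain f) rs) =
          (0, s ((-1) ^ (n + 1)) (s ((-1) ^ j) (A j - B j)))"
        by (simp only: scl_C sign fst_conv snd_conv mult_zero_right scale_scale)
    qed simp
    also have "\<dots> = (0, s ((-1) ^ (n + 1)) (\<Sum>j=2..n+1. s ((-1) ^ j) (A j - B j)))"
      by (simp only: sum_prod scale_sum_right sum.neutral_const)
    finally have *: "deform_diff C n (lift_cochain f) rs = (0, s ((-1) ^ (n + 1))
        (bracket (?xs ! 0) (f (drop 1 ?xs)) + (\<Sum>j=2..n+1. s ((-1) ^ j) (A j - B j))))"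
      using len by (cases rs) (simp_all add: deform_diff_def face_last_lift[OF f] scl_C rack_C
          lift_cochain_def scale_right_distrib add.commute)
    have "(\<Sum>j=1..n+1. \<Sum>i=1..<j. s ((-1) ^ (j + 1))
          (f (take (j - 1) (?xs[i - 1 := bracket (?xs ! (i - 1)) (?xs ! (j - 1))]) @ drop j ?xs)))
        = (\<Sum>j=1..n+1. s ((-1) ^ (j + 1)) (B j))"
      by (simp add: B_def scale_sum_right)
    \<comment> \<open>The first argument has none to its left, so \<open>B 1\<close> is an empty
      sum.\<close>
    also have "\<dots> = (\<Sum>j=2..n+1. s ((-1) ^ (j + 1)) (B j))"
      by (subst sum.atLeast_Suc_atMost) (auto simp: B_def numeral_2_eq_2)
    finally have "leibniz_diff s bracket n f ?xs =
        bracket (?xs ! 0) (f (drop 1 ?xs)) + (\<Sum>j=2..n+1. s ((-1) ^ j) (A j - B j))"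
      using len by (simp add: leibniz_diff_def A_def scale_right_diff_distrib sum_subtractf sum_negf)
    then show ?thesis using * by (simp add: lift_cochain_def)
  qed
qed

section \<open>The lift as an embedding of complexes\<close>

text \<open>Lets the degree-dependent sign pass through the differential.\<close>

lemma leibniz_diff_scale:
  "leibniz_diff s bracket n (\<lambda>xs. s c (f xs)) xs = s c (leibniz_diff s bracket n f xs)"
  by (simp only: leibniz_diff_def bl.scale br.scale scale_right_distrib scale_sum_right
      scale_left_commute[of _ c] scale_zero_right if_distrib[of "s c"])

text \<open>
  With the sign \<open>(-1)\<^sup>n\<^sup>+\<^sup>1\<close> of the last face, the lift satisfies \<open>d\<^sub>C \<circ> lift = (-1)\<^sup>n\<^sup>+\<^sup>1 lift \<circ> d\<close>
  in degree \<open>n\<close>; multiplying it by \<open>(-1)\<^sup>1\<^sup>+\<^sup>\<dots>\<^sup>+\<^sup>n\<close> makes it a chain map.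
\<close>

theorem cochain_embedding_lift:
  "cochain_embedding s (tensor_hom s s) (leibniz_diff s bracket) (scl C) (Coder C) (deform_diff C)
    (\<lambda>n f. lift_cochain (\<lambda>xs. s ((-1) ^ (\<Sum>{1..n})) (f xs)))"
  unfolding cochain_embedding_def
proof (intro allI conjI ballI)
  fix n
  let ?c = "(-1 :: 'k) ^ (\<Sum>{1..n})"
  let ?\<Phi> = "\<lambda>f. lift_cochain (\<lambda>xs. s ?c (f xs))"
  show "?\<Phi> ` tensor_hom s s n \<subseteq> Coder C n"
    by (auto intro!: lift_cochain_Coder tensor_hom_scale vector_space_axioms)
  show "inj_on ?\<Phi> (tensor_hom s s n)"
  proof (rule inj_onI, rule ext)
    fix f g xs
    assume "?\<Phi> f = ?\<Phi> g"
    \<comment> \<open>Entries \<open>(0, x)\<close> recover \<open>s ?c (f xs)\<close>, and the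
      nonzero sign \<open>?c\<close> can be cancelled.\<close>
    then have "?\<Phi> f (map (Pair 0) xs) = ?\<Phi> g (map (Pair 0) xs)" by simp
    then show "f xs = g xs" by (simp add: lift_cochain_def o_def)
  qed
  fix f assume f: "f \<in> tensor_hom s s n"
  show "?\<Phi> (\<lambda>xs. f xs + g xs) = (\<lambda>rs. ?\<Phi> f rs + ?\<Phi> g rs)" for g
    by (simp add: lift_cochain_def scale_right_distrib fun_eq_iff)
  show "?\<Phi> (\<lambda>xs. s c (f xs)) = (\<lambda>rs. scl C c (?\<Phi> f rs))" for c
    by (simp add: lift_cochain_def scl_C mult.commute fun_eq_iff)
  show "lift_cochain (\<lambda>xs. s ((-1) ^ (\<Sum>{1..Suc n})) (leibniz_diff s bracket n f xs)) =
      deform_diff C n (?\<Phi> f)"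
    using tensor_hom_scale[OF vector_space_axioms f]
    by (simp add: deform_diff_lift leibniz_diff_scale power_add mult.commute)
qed

end

theorem theorem3:
  fixes s :: "'k::field \<Rightarrow> 'h::ab_group_add \<Rightarrow> 'h"
    and bracket :: "'h \<Rightarrow> 'h \<Rightarrow> 'h"
    and C :: "('k, 'k \<times> 'h) rack_data"
  assumes "leibniz_algebra s bracket"
    and "C = leibniz_rack s bracket"
  shows "\<exists>\<Phi>. cochain_embedding
    s (tensor_hom s s) (leibniz_diff s bracket)
    (scl C) (Coder C) (deform_diff C) \<Phi>"
  using leibniz_algebra.cochain_embedding_lift[OF assms(1)] assms(2) by blast

end
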